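(* The assignment $x\mapsto[\mathrm{Ind}]$, $y\mapsto[\mathrm{Res}]$, $c_k\mapsto[P_k]$ $(k\ge 0)$ defines an asymptotic representation of the filtered algebra $\mathcal K$ on the filtered vector space $\mathcal{TL}=K_0(\mathbf{TL})$. That is, there is an asymptotic representation $f_{n,m}:\mathcal K_n\otimes\mathcal{TL}_m\to\mathcal{TL}_{m-n}$ $(m\ge n\ge0)$ in which $c_k\in\mathcal K_0$ acts by $[P_k]$ and $x,y\in\mathcal K_1$ act by $[\mathrm{Ind}]$ and $[\mathrm{Res}]$ respectively.
   Context: **The algebra $\mathcal K$.** The unital associative $\mathbb C(q)$-algebra with generators $x,y$ and $c_k$ ($k\ge0$; $c_{j}:=0$ for $j<0$) and relations, for all $k,\ell\ge0$: - $yx=xy+c_0$; $c_kc_\ell=\delta_{k\ell}c_k$; - $c_kx=c_kx(c_k+c_{k-1})$; $xc_k=(c_k+c_{k+1})xc_k$; $c_ky=c_ky(c_k+c_{k+1})$; $yc_k=(c_k+c_{k-1})yc_k$; - $c_{k+1}xc_kxc_k=c_{k+1}xc_{k+1}xc_k$; $c_kyc_{k+1}yc_{k+1}=c_kyc_kyc_{k+1}$; - $c_kyc_kxc_k=c_k$; $c_{k-1}yc_kxc_{k-1}=c_{k-1}$; $c_kxc_kyc_k=c_k$; $c_kxc_{k-1}yc_k=c_k$ for $k\ge1$; - $yc_kx=c_k+c_{k-1}+c_kxyc_{k-1}+c_{k-1}xyc_k$; $xc_ky=c_k+c_{k+1}+c_kxyc_{k+1}+c_{k+1}xyc_k$; $yc_0x=c_0$.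 Give words the degree with $\deg x=\deg y=1$, $\deg c_k=0$; $\mathcal K_n\subset\mathcal K$ is the subspace spanned by words of degree $\le n$. **The space $\mathcal{TL}$.** $\mathbf{TL}$ is the direct sum over $n$ of the categories of modules over the Temperley-Lieb algebras $TL_n$ over $\mathbb C(q)$. $\mathcal{TL}=K_0(\mathbf{TL})$, with scalars extended to $\mathbb C(q)$, has as basis the classes of simple modules $[W^n_m]$, $0\le m\le n$, $m\equiv n\bmod 2$; put $[W^n_m]=0$ for all other $(n,m)$. Here $[\mathrm{Ind}],[\mathrm{Res}],[P_k]$ are the endomorphisms induced by induction, restriction, and projection onto the $W^n_{n-2k}$-isotypic component: $$[\mathrm{Ind}][W^n_m]=[W^{n+1}_{m+1}]+[W^{n+1}_{m-1}],\quad [\mathrm{Res}][W^n_m]=[W^{n-1}_{m+1}]+[W^{n-1}_{m-1}],\quad [P_k][W^n_m]=\delta_{m,n-2k}[W^n_m]$$ for basis elements $[W^n_m]$. $\mathcal{TL}_j$ is the subspace spanned by the $[W^n_m]$ with $n\ge m\ge j$, so $\mathcal{TL}_{j+1}\subset\mathcal{TL}_j$. **Asymptotic representation.** Let $A$ be an algebra with increasing filtration $i_n:A_n\hookrightarrow A_{n+1}$ (with multiplication $\mu_{l,n}:A_l\otimes A_n\to A_{l+n}$) and $V$ a vector space with decreasing filtration $j_{n+1}:V_{n+1}\hookrightarrow V_n$. An asymptotic representation of $A$ on $V$ is a collection of linear maps $f_{n,m}:A_n\otimes V_m\to V_{m-n}$ for $m\ge n\ge0$ such that - $f_{n+1,m+1}\circ(i_n\otimes\mathrm{id}_{V_{m+1}})=j_{m-n+1}\circ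 f_{n,m+1}$ as maps $A_n\otimes V_{m+1}\to V_{m-n}$; - $f_{n,m}\circ(\mathrm{id}_{A_n}\otimes j_{m+1})=j_{m-n+1}\circ f_{n,m+1}$ as maps $A_n\otimes V_{m+1}\to V_{m-n}$; - $f_{n+l,m}\circ(\mu_{l,n}\otimes\mathrm{id}_{V_m})=f_{l,m-n}\circ(\mathrm{id}_{A_l}\otimes f_{n,m})$ as maps $A_l\otimes A_n\otimes V_m\to V_{m-n-l}$, for $m\ge n+l$. *)

theory Defs
  imports
    Complex_Main
    "HOL-Library.Poly_Mapping"
    "HOL-Computational_Algebra.Polynomial"
    "HOL-Computational_Algebra.Fraction_Field"
begin

type_synonym cq = "complex poly fract"  \<comment> \<open>the field of rational functions over the complex numbers\<close>

section \<open>The algebra K\<close>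

datatype gen = GenX | GenY | GenC nat

datatype gen_word = Word (letters: "gen list")

text \<open>Words are written additively because the convolution product of the type
  \<open>_ \<Rightarrow>\<^sub>0 _\<close> is taken over an additive monoid.  Consequently
  \<open>gen_word \<Rightarrow>\<^sub>0 cq\<close> is the free unital associative algebra on the generators.\<close>

instantiation gen_word :: monoid_add
begin

definition zero_gen_word :: gen_word
  where "0 = Word []"

definition plus_gen_word :: "gen_word \<Rightarrow> gen_word \<Rightarrow> gen_word"
  where "u + v = Word (letters u @ letters v)"

instance
  by standard (simp_all add: zero_gen_word_def plus_gen_word_def)

end

type_synonym free_alg = "gen_word \<Rightarrow>\<^sub>0 cq"

definition free_scalar :: "cq \<Rightarrow> free_alg"
  where "free_scalar a = Poly_Mapping.single 0 a"

definition free_gen :: "gen \<Rightarrow> free_alg"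
  where "free_gen g = Poly_Mapping.single (Word [g]) 1"

definition fx :: free_alg
  where "fx = free_gen GenX"

definition fy :: free_alg
  where "fy = free_gen GenY"

definition fc :: "int \<Rightarrow> free_alg"
  where "fc j = (if j < 0 then 0 else free_gen (GenC (nat j)))"

text \<open>The guard \<open>k \<ge> 1\<close> is attached to the fourth of the relations with right-hand side a
  single idempotent.  The other three hold at \<open>k = 0\<close> as well: they then follow from
  \<open>fy * fc 0 * fx = fc 0\<close>, are trivial, or follow from the relation for
  \<open>fx * fc 0 * fy\<close>, so attaching the guard to them too gives the same algebra.\<close>

inductive K_rel :: "free_alg \<Rightarrow> free_alg \<Rightarrow> bool" where
  "K_rel (fy * fx) (fx * fy + fc 0)"
| "k \<ge> 0 \<Longrightarrow> l \<ge> 0 \<Longrightarrow> K_rel (fc k * fc l) (if k = l then fc k else 0)"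
| "k \<ge> 0 \<Longrightarrow> K_rel (fc k * fx) (fc k * fx * (fc k + fc (k - 1)))"
| "k \<ge> 0 \<Longrightarrow> K_rel (fx * fc k) ((fc k + fc (k + 1)) * fx * fc k)"
| "k \<ge> 0 \<Longrightarrow> K_rel (fc k * fy) (fc k * fy * (fc k + fc (k + 1)))"
| "k \<ge> 0 \<Longrightarrow> K_rel (fy * fc k) ((fc k + fc (k - 1)) * fy * fc k)"
| "k \<ge> 0 \<Longrightarrow> K_rel (fc (k + 1) * fx * fc k * fx * fc k) (fc (k + 1) * fx * fc (k + 1) * fx * fc k)"
| "k \<ge> 0 \<Longrightarrow> K_rel (fc k * fy * fc (k + 1) * fy * fc (k + 1)) (fc k * fy * fc k * fy * fc (k + 1))"
| "k \<ge> 0 \<Longrightarrow> K_rel (fc k * fy * fc k * fx * fc k) (fc k)"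
| "k \<ge> 0 \<Longrightarrow> K_rel (fc (k - 1) * fy * fc k * fx * fc (k - 1)) (fc (k - 1))"
| "k \<ge> 0 \<Longrightarrow> K_rel (fc k * fx * fc k * fy * fc k) (fc k)"
| "k \<ge> 1 \<Longrightarrow> K_rel (fc k * fx * fc (k - 1) * fy * fc k) (fc k)"
| "k \<ge> 0 \<Longrightarrow> K_rel (fy * fc k * fx)
     (fc k + fc (k - 1) + fc k * fx * fy * fc (k - 1) + fc (k - 1) * fx * fy * fc k)"
| "k \<ge> 0 \<Longrightarrow> K_rel (fx * fc k * fy)
     (fc k + fc (k + 1) + fc k * fx * fy * fc (k + 1) + fc (k + 1) * fx * fy * fc k)"
| "K_rel (fy * fc 0 * fx) (fc 0)"

text \<open>The least ring congruence containing the relations.  It is automatically compatible with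
  scalars, which lie in the free algebra as multiples of the empty word; so it is congruence
  modulo the two-sided ideal generated by the relations.\<close>

inductive K_cong :: "free_alg \<Rightarrow> free_alg \<Rightarrow> bool" where
  base: "K_rel a b \<Longrightarrow> K_cong a b"
| refl: "K_cong a a"
| sym: "K_cong a b \<Longrightarrow> K_cong b a"
| trans: "K_cong a b \<Longrightarrow> K_cong b d \<Longrightarrow> K_cong a d"
| add: "K_cong a a' \<Longrightarrow> K_cong b b' \<Longrightarrow> K_cong (a + b) (a' + b')"
| mult: "K_cong a a' \<Longrightarrow> K_cong b b' \<Longrightarrow> K_cong (a * b) (a' * b')"

lemma K_cong_equivp: "equivp K_cong"
  by (intro equivpI reflpI sympI transpI) (auto intro: K_cong.intros)

lemma K_cong_uminus: "K_cong a b \<Longrightarrow> K_cong (- a) (- b)"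
  using K_cong.mult[OF K_cong.refl[of "- 1"], of a b] by simp

quotient_type K_alg = free_alg / K_cong
  by (rule K_cong_equivp)

text \<open>The class \<open>ring_1\<close> would require \<open>0 \<noteq> 1\<close> as well; this is not needed here.\<close>

instantiation K_alg :: "{ring, monoid_mult}"
begin

lift_definition zero_K_alg :: K_alg is 0 .
lift_definition one_K_alg :: K_alg is 1 .
lift_definition plus_K_alg :: "K_alg \<Rightarrow> K_alg \<Rightarrow> K_alg" is "(+)" by (rule K_cong.add)
lift_definition times_K_alg :: "K_alg \<Rightarrow> K_alg \<Rightarrow> K_alg" is "(*)" by (rule K_cong.mult)
lift_definition uminus_K_alg :: "K_alg \<Rightarrow> K_alg" is uminus by (rule K_cong_uminus)
lift_definition minus_K_alg :: "K_alg \<Rightarrow> K_alg \<Rightarrow> K_alg" is "(-)"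
  using K_cong.add K_cong_uminus by (metis diff_conv_add_uminus)

instance
  by standard (transfer, simp add: algebra_simps K_cong.refl)+

end

lift_definition K_scale :: "cq \<Rightarrow> K_alg \<Rightarrow> K_alg" is "\<lambda>a p. free_scalar a * p"
  by (intro K_cong.mult K_cong.refl)

lift_definition K_gen :: "gen \<Rightarrow> K_alg" is free_gen .

definition K_x :: K_alg where "K_x = K_gen GenX"
definition K_y :: K_alg where "K_y = K_gen GenY"
definition K_c :: "nat \<Rightarrow> K_alg" where "K_c k = K_gen (GenC k)"

primrec gen_degree :: "gen \<Rightarrow> nat" where
  "gen_degree GenX = 1"
| "gen_degree GenY = 1"
| "gen_degree (GenC k) = 0"

definition word_degree :: "gen list \<Rightarrow> nat"
  where "word_degree w = sum_list (map gen_degree w)"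

definition K_filt :: "nat \<Rightarrow> K_alg set"
  where "K_filt n = module.span K_scale {prod_list (map K_gen w) | w. word_degree w \<le> n}"

section \<open>The space TL\<close>

definition TL_index :: "(int \<times> int) set"
  where "TL_index = {(n, m). 0 \<le> m \<and> m \<le> n \<and> even (n - m)}"

text \<open>A space with a basis indexed by the classes \<open>[W\<^sup>n\<^sub>m]\<close> of the simple Temperley-Lieb
  modules, together with the endomorphisms of induction, restriction and projection.  The Grothendieck group of the
  Temperley-Lieb categories, with scalars extended, is an instance, with \<open>W n m\<close> the class of the
  simple module \<open>W\<^sup>n\<^sub>m\<close>.  The data are determined up to isomorphism.  Indices are integers so
  that \<open>m - 1\<close> and \<open>n - 1\<close> are not truncated.\<close>

locale TL_space = vector_space scale
  for scale :: "cq \<Rightarrow> 'v::ab_group_add \<Rightarrow> 'v" +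
  fixes W :: "int \<Rightarrow> int \<Rightarrow> 'v"
    and Ind Res :: "'v \<Rightarrow> 'v"
    and P :: "nat \<Rightarrow> 'v \<Rightarrow> 'v"
  assumes W_inj: "inj_on (\<lambda>(n, m). W n m) TL_index"
    and W_independent: "independent ((\<lambda>(n, m). W n m) ` TL_index)"
    and W_span: "span ((\<lambda>(n, m). W n m) ` TL_index) = UNIV"
    and W_zero: "(n, m) \<notin> TL_index \<Longrightarrow> W n m = 0"
    and Ind_linear: "Vector_Spaces.linear scale scale Ind"
    and Res_linear: "Vector_Spaces.linear scale scale Res"
    and P_linear: "Vector_Spaces.linear scale scale (P k)"
    and Ind_W: "(n, m) \<in> TL_index \<Longrightarrow> Ind (W n m) = W (n + 1) (m + 1) + W (n + 1) (m - 1)"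
    and Res_W: "(n, m) \<in> TL_index \<Longrightarrow> Res (W n m) = W (n - 1) (m + 1) + W (n - 1) (m - 1)"
    and P_W: "(n, m) \<in> TL_index \<Longrightarrow> P k (W n m) = (if m = n - 2 * int k then W n m else 0)"
begin

definition TL_filt :: "nat \<Rightarrow> 'v set"
  where "TL_filt j = span {W n m | n m. (n, m) \<in> TL_index \<and> m \<ge> int j}"

end

text \<open>The locale is inhabited: the basis element for \<open>(n, m)\<close> in the model is the monomial with
  key \<open>((n - m) / 2, m)\<close>.\<close>

lemma TL_space_exists:
  "\<exists>(scale :: cq \<Rightarrow> (nat \<times> nat \<Rightarrow>\<^sub>0 cq) \<Rightarrow> (nat \<times> nat \<Rightarrow>\<^sub>0 cq)) W Ind Res P.
     TL_space scale W Ind Res P"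
proof -
  define sc :: "cq \<Rightarrow> (nat \<times> nat \<Rightarrow>\<^sub>0 cq) \<Rightarrow> (nat \<times> nat \<Rightarrow>\<^sub>0 cq)"
    where "sc = (\<lambda>a. Poly_Mapping.map ((*) a))"
  have lookup_sc: "Poly_Mapping.lookup (sc a p) x = a * Poly_Mapping.lookup p x" for a p x
    by (simp add: sc_def Poly_Mapping.map.rep_eq when_def)
  interpret vector_space sc
    by standard (auto intro!: poly_mapping_eqI simp: lookup_sc lookup_add algebra_simps)
  interpret pair: vector_space_pair sc sc ..
  define e :: "nat \<times> nat \<Rightarrow> (nat \<times> nat \<Rightarrow>\<^sub>0 cq)" where "e = (\<lambda>x. Poly_Mapping.single x 1)"
  define W where "W n m = (if (n, m) \<in> TL_index then e (nat ((n - m) div 2), nat m) else 0)"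
    for n m :: int
  have inj_e: "inj e"
    by (rule injI) (metis e_def lookup_single_eq lookup_single_not_eq zero_neq_one)
  have image_W: "(\<lambda>(n, m). W n m) ` TL_index = range e"
  proof
    show "(\<lambda>(n, m). W n m) ` TL_index \<subseteq> range e"
      by (auto simp: W_def)
    have "e (k, m) = (\<lambda>(n, m). W n m) (2 * int k + int m, int m)
        \<and> (2 * int k + int m, int m) \<in> TL_index" for k m
      by (simp add: W_def TL_index_def)
    then show "range e \<subseteq> (\<lambda>(n, m). W n m) ` TL_index"
      by (smt (verit) image_iff image_subset_iff surj_pair)
  qed
  have inj_W: "inj_on (\<lambda>(n, m). W n m) TL_index"
  proof (rule inj_onI, clarify)
    fix n m n' m'
    assume adm: "(n, m) \<in> TL_index" "(n', m') \<in> TL_index" and "W n m = W n' m'"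
    then have "(nat ((n - m) div 2), nat m) = (nat ((n' - m') div 2), nat m')"
      by (simp add: W_def inj_eq[OF inj_e])
    then have eqs: "nat ((n - m) div 2) = nat ((n' - m') div 2)" "nat m = nat m'"
      by simp_all
    have "0 \<le> m" "0 \<le> m'" "m \<le> n" "m' \<le> n'" "even (n - m)" "even (n' - m')"
      using adm unfolding TL_index_def by blast+
    then have "m = m'" and "(n - m) div 2 = (n' - m') div 2"
      using eqs by linarith+
    then show "n = n' \<and> m = m'"
      using dvd_mult_div_cancel[OF \<open>even (n - m)\<close>] dvd_mult_div_cancel[OF \<open>even (n' - m')\<close>]
      by linarith
  qed
  have lookup_e: "Poly_Mapping.lookup (e x) y = (if x = y then 1 else 0)" for x y
    by (simp add: e_def lookup_single when_def)
  have lookup_e: "Poly_Mapping.lookup (e x) y = (if x = y then 1 else 0)" for x y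
    by (simp add: e_def lookup_single when_def)
  have indep: "independent (range e)"
    unfolding independent_explicit_module
  proof (intro allI impI)
    fix T u v
    assume "finite T" "T \<subseteq> range e" and sum0: "(\<Sum>w\<in>T. sc (u w) w) = 0" and "v \<in> T"
    then obtain x where x: "v = e x"
      by blast
    have "0 = (\<Sum>w\<in>T. u w * Poly_Mapping.lookup w x)"
      using arg_cong[OF sum0, of "\<lambda>p. Poly_Mapping.lookup p x"] by (simp add: lookup_sum lookup_sc)
    also have "\<dots> = (\<Sum>w\<in>T. if w = v then u v else 0)"
    proof (rule sum.cong[OF HOL.refl])
      fix w
      assume "w \<in> T"
      then obtain z where "w = e z"
        using \<open>T \<subseteq> range e\<close> by blast
      then show "u w * Poly_Mapping.lookup w x = (if w = v then u v else 0)"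
        by (simp add: x lookup_e inj_eq[OF inj_e])
    qed
    also have "\<dots> = u v"
      using \<open>finite T\<close> \<open>v \<in> T\<close> by simp
    finally show "u v = 0"
      by simp
  qed
  have "p \<in> span (range e)" for p
  proof -
    have "p = (\<Sum>x\<in>Poly_Mapping.keys p. sc (Poly_Mapping.lookup p x) (e x))"
      by (rule poly_mapping_eqI)
        (simp add: lookup_sum lookup_sc lookup_e in_keys_iff if_distrib cong: if_cong)
    also have "\<dots> \<in> span (range e)"
      by (intro span_sum span_scale span_base) simp
    finally show ?thesis .
  qed
  then have spn: "span (range e) = UNIV"
    by blast
  have ext: "\<exists>g. Vector_Spaces.linear sc sc g \<and> (\<forall>n m. (n, m) \<in> TL_index \<longrightarrow> g (W n m) = h n m)"
    for h
  proof -
    let ?i = "inv_into TL_index (\<lambda>(n, m). W n m)"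
    obtain g where lin: "Vector_Spaces.linear sc sc g"
      and g: "\<forall>b \<in> range e. g b = (\<lambda>(n, m). h n m) (?i b)"
      using pair.linear_independent_extend[OF indep, of "\<lambda>b. (\<lambda>(n, m). h n m) (?i b)"] by blast
    have "g (W n m) = h n m" if "(n, m) \<in> TL_index" for n m
    proof -
      have "W n m \<in> range e"
        using that by (simp add: W_def)
      moreover have "?i (W n m) = (n, m)"
        using inv_into_f_f[OF inj_W that] by simp
      ultimately show ?thesis
        using bspec[OF g, of "W n m"] by (simp only: prod.case)
    qed
    with lin show ?thesis
      by (intro exI[of _ g]) simp
  qed
  define ex where "ex h = (SOME g. Vector_Spaces.linear sc sc g
      \<and> (\<forall>n m. (n, m) \<in> TL_index \<longrightarrow> g (W n m) = h n m))" for h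
  have ex: "Vector_Spaces.linear sc sc (ex h)" "(n, m) \<in> TL_index \<Longrightarrow> ex h (W n m) = h n m" for h n m
    using someI_ex[OF ext[of h]] by (simp_all add: ex_def)
  have "TL_space sc W
      (ex (\<lambda>n m. W (n + 1) (m + 1) + W (n + 1) (m - 1)))
      (ex (\<lambda>n m. W (n - 1) (m + 1) + W (n - 1) (m - 1)))
      (\<lambda>k. ex (\<lambda>n m. if m = n - 2 * int k then W n m else 0))"
  proof (intro TL_space.intro TL_space_axioms.intro)
    show "vector_space sc" ..
  qed (simp_all only: ex inj_W image_W indep spn, simp_all add: W_def)
  then show ?thesis
    by blast
qed

section \<open>Asymptotic representations\<close>

locale filtered_algebra = vector_space scale
  for scale :: "'k::field \<Rightarrow> 'a::ring \<Rightarrow> 'a" +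
  fixes A :: "nat \<Rightarrow> 'a set"
  assumes scale_mult_left: "scale r a * b = scale r (a * b)"
    and scale_mult_right: "a * scale r b = scale r (a * b)"
    and A_subspace: "subspace (A n)"
    and A_mono: "A n \<subseteq> A (Suc n)"
    and A_mult: "a \<in> A l \<Longrightarrow> b \<in> A n \<Longrightarrow> a * b \<in> A (l + n)"

locale decreasing_filtered_space = vector_space scale
  for scale :: "'k::field \<Rightarrow> 'v::ab_group_add \<Rightarrow> 'v" +
  fixes V :: "nat \<Rightarrow> 'v set"
  assumes V_subspace: "subspace (V n)"
    and V_antimono: "V (Suc n) \<subseteq> V n"

text \<open>A linear map out of the tensor product of \<open>A n\<close> and \<open>V m\<close> is given as a bilinear map
  \<open>f n m\<close> on these subspaces.  Its values outside of \<open>A n\<close> and \<open>V m\<close>, and for \<open>m < n\<close>, are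
  irrelevant.  The inclusions of the filtrations are inclusions of subsets, hence invisible in the
  compatibility conditions.\<close>

locale asymptotic_representation =
  alg: filtered_algebra scaleA A + vec: decreasing_filtered_space scaleV V
  for scaleA :: "'k::field \<Rightarrow> 'a::ring \<Rightarrow> 'a" and A :: "nat \<Rightarrow> 'a set"
    and scaleV :: "'k \<Rightarrow> 'v::ab_group_add \<Rightarrow> 'v" and V :: "nat \<Rightarrow> 'v set" +
  fixes f :: "nat \<Rightarrow> nat \<Rightarrow> 'a \<Rightarrow> 'v \<Rightarrow> 'v"
  assumes f_closed: "n \<le> m \<Longrightarrow> a \<in> A n \<Longrightarrow> v \<in> V m \<Longrightarrow> f n m a v \<in> V (m - n)"
    and f_add_left: "n \<le> m \<Longrightarrow> a \<in> A n \<Longrightarrow> b \<in> A n \<Longrightarrow> v \<in> V m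
      \<Longrightarrow> f n m (a + b) v = f n m a v + f n m b v"
    and f_scale_left: "n \<le> m \<Longrightarrow> a \<in> A n \<Longrightarrow> v \<in> V m
      \<Longrightarrow> f n m (scaleA r a) v = scaleV r (f n m a v)"
    and f_add_right: "n \<le> m \<Longrightarrow> a \<in> A n \<Longrightarrow> v \<in> V m \<Longrightarrow> w \<in> V m
      \<Longrightarrow> f n m a (v + w) = f n m a v + f n m a w"
    and f_scale_right: "n \<le> m \<Longrightarrow> a \<in> A n \<Longrightarrow> v \<in> V m
      \<Longrightarrow> f n m a (scaleV r v) = scaleV r (f n m a v)"
    and f_incl_algebra: "n \<le> m \<Longrightarrow> a \<in> A n \<Longrightarrow> v \<in> V (m + 1)
      \<Longrightarrow> f (n + 1) (m + 1) a v = f n (m + 1) a v"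
    and f_incl_space: "n \<le> m \<Longrightarrow> a \<in> A n \<Longrightarrow> v \<in> V (m + 1)
      \<Longrightarrow> f n m a v = f n (m + 1) a v"
    and f_mult: "n + l \<le> m \<Longrightarrow> a \<in> A l \<Longrightarrow> b \<in> A n \<Longrightarrow> v \<in> V m
      \<Longrightarrow> f (n + l) m (a * b) v = f l (m - n) a (f n m b v)"

end

theory Submission
  imports Defs
begin

text \<open>Allowing negative \<open>m\<close> in the symbols \<open>W\<^sup>n\<^sub>m\<close>, \<open>m \<le> n\<close>, turns the assignment into a genuine
  representation of the algebra: a vector of the enlarged space is recorded by its coefficients
  \<open>g k m\<close> at \<open>W\<^sup>2\<^sup>k\<^sup>+\<^sup>m\<^sub>m\<close>.  A word of degree at most \<open>n\<close> lowers \<open>m\<close> by at most \<open>n\<close>, so on the part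
  \<open>m \<ge> n\<close> of the filtration it never meets negative indices, and there it agrees with the
  corresponding composite of induction, restriction and projections.  Comparing with a genuine
  representation is what makes the action of \<open>K_filt n\<close> well defined, even though a relation
  between words of degree at most \<open>n\<close> might only be derivable through words of higher degree.\<close>

section \<open>The enlarged representation\<close>

type_synonym coeffs = "nat \<Rightarrow> int \<Rightarrow> cq"

text \<open>The basis maps read backwards. Induction sends position \<open>(k, m)\<close> to
  \<open>(k, m + 1)\<close> and \<open>(k + 1, m - 1)\<close>, restriction sends it to
  \<open>(k - 1, m + 1)\<close> and \<open>(k, m - 1)\<close>; each clause gathers what arrives at
  \<open>(k, m)\<close>. The case \<open>k = 0\<close> stops truncated subtraction from reading
  index 0 in place of -1, where \<open>m\<close> would exceed the upper index.\<close>

primrec gen_op :: "gen \<Rightarrow> coeffs \<Rightarrow> coeffs" where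
  "gen_op GenX g = (\<lambda>k m. g k (m - 1) + (if k = 0 then 0 else g (k - 1) (m + 1)))"
| "gen_op GenY g = (\<lambda>k m. g k (m + 1) + g (k + 1) (m - 1))"
| "gen_op (GenC j) g = (\<lambda>k m. if k = j then g k m else 0)"

abbreviation word_op :: "gen list \<Rightarrow> coeffs \<Rightarrow> coeffs"
  where "word_op \<equiv> foldr gen_op"

lemma word_op_add: "word_op w (\<lambda>k m. g k m + h k m) = (\<lambda>k m. word_op w g k m + word_op w h k m)"
proof (induction w)
  case (Cons a w)
  then show ?case by (cases a) (auto simp: fun_eq_iff algebra_simps)
qed simp

lemma word_op_scale: "word_op w (\<lambda>k m. r * g k m) = (\<lambda>k m. r * word_op w g k m)"
proof (induction w)
  case (Cons a w)
  then show ?case by (cases a) (auto simp: fun_eq_iff algebra_simps)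
qed simp

lemma word_op_zero: "word_op w (\<lambda>k m. 0) = (\<lambda>k m. 0)"
  using word_op_scale[of w 0 "\<lambda>k m. 0"] by simp

section \<open>Extending the operators from words to the free algebra\<close>

definition free_op :: "free_alg \<Rightarrow> coeffs \<Rightarrow> coeffs" where
  "free_op p g = (\<lambda>k m. \<Sum>w\<in>Poly_Mapping.keys p. Poly_Mapping.lookup p w * word_op (letters w) g k m)"

text \<open>Cancellation can shrink the support of a sum, so supports are enlarged to a common
  finite set before sums are compared.\<close>

lemma free_op_superset:
  assumes "finite A" "Poly_Mapping.keys p \<subseteq> A"
  shows "free_op p g k m = (\<Sum>w\<in>A. Poly_Mapping.lookup p w * word_op (letters w) g k m)"
  unfolding free_op_def using assms by (intro sum.mono_neutral_left) (auto simp: in_keys_iff)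

lemma free_op_plus: "free_op (p + q) g = (\<lambda>k m. free_op p g k m + free_op q g k m)"
proof (intro ext)
  fix k m
  let ?A = "Poly_Mapping.keys p \<union> Poly_Mapping.keys q"
  show "free_op (p + q) g k m = free_op p g k m + free_op q g k m"
    using keys_add[of p q]
    by (simp add: free_op_superset[of ?A] lookup_add algebra_simps sum.distrib)
qed

lemma free_op_single: "free_op (Poly_Mapping.single w r) g = (\<lambda>k m. r * word_op (letters w) g k m)"
  by (simp add: fun_eq_iff free_op_superset[of "{w}"])

lemma free_op_zero: "free_op 0 g = (\<lambda>k m. 0)"
  by (simp add: free_op_def)

lemma free_op_add_right:
  "free_op p (\<lambda>k m. g k m + h k m) = (\<lambda>k m. free_op p g k m + free_op p h k m)"
  by (simp add: free_op_def word_op_add algebra_simps sum.distrib)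

lemma free_op_scale_right: "free_op p (\<lambda>k m. r * g k m) = (\<lambda>k m. r * free_op p g k m)"
  by (simp add: free_op_def word_op_scale sum_distrib_left algebra_simps)

lemma poly_mapping_single_add_induct [case_names zero add]:
  fixes p :: "'a \<Rightarrow>\<^sub>0 'b::monoid_add"
  assumes "Q 0" "\<And>w r p. Q p \<Longrightarrow> Q (Poly_Mapping.single w r + p)"
  shows "Q p"
proof (induction p rule: Poly_Mapping.update_induct)
  case const
  then show ?case using assms(1) by simp
next
  case (update f a b)
  have "Poly_Mapping.update a b f = Poly_Mapping.single a b + f"
    using update by (intro poly_mapping_eqI)
      (auto simp: lookup_update lookup_add lookup_single when_def in_keys_iff)
  with update assms(2) show ?case by simp
qed

text \<open>By bilinearity two monomials suffice; for them the product concatenates words, and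
  \<open>foldr\<close> over an append is composition, the right factor acting first.\<close>

lemma free_op_times: "free_op (p * q) g = free_op p (free_op q g)"
proof (induction p rule: poly_mapping_single_add_induct)
  case zero
  then show ?case by (simp add: free_op_zero)
next
  case (add w r p)
  have "free_op (Poly_Mapping.single w r * q) g = free_op (Poly_Mapping.single w r) (free_op q g)"
  proof (induction q rule: poly_mapping_single_add_induct)
    case zero
    then show ?case by (simp add: free_op_zero free_op_single word_op_zero)
  next
    case (add u s q)
    then show ?case
      by (simp add: distrib_left free_op_plus free_op_add_right mult_single free_op_single
          plus_gen_word_def word_op_scale algebra_simps)
  qed
  with add show ?case by (simp add: distrib_right free_op_plus)
qed

lemma free_op_one: "free_op 1 g = g"
  using free_op_single[of 0 1 g] unfolding single_one by (simp add: zero_gen_word_def)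

lemma free_op_gen: "free_op (free_gen a) g = gen_op a g"
  by (simp add: free_gen_def free_op_single)

section \<open>Passing to the quotient by the relations\<close>

lemma free_op_fc: "free_op (fc j) g = (\<lambda>k m. if int k = j then g k m else 0)"
  by (auto simp: fc_def free_op_gen free_op_zero fun_eq_iff)

text \<open>Each relation becomes a pointwise identity of coefficients. With no boundary in
  \<open>m\<close>, the only boundary is \<open>k = 0\<close>, and it accounts for the terms
  \<open>fc 0\<close> in the relations for \<open>fy * fx\<close> and
  \<open>fy * fc 0 * fx\<close>.\<close>

lemma K_rel_free_op: "K_rel a b \<Longrightarrow> free_op a g = free_op b g"
  by (induction rule: K_rel.induct; simp only: free_op_times free_op_plus free_op_fc fx_def fy_def
      free_op_gen gen_op.simps)
    (auto simp: fun_eq_iff free_op_zero free_op_fc of_nat_diff algebra_simps)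

lemma K_cong_free_op: "K_cong a b \<Longrightarrow> free_op a = free_op b"
proof (induction rule: K_cong.induct)
  case (base a b)
  then show ?case using K_rel_free_op by blast
qed (rule ext, simp add: free_op_plus free_op_times)+

lift_definition K_op :: "K_alg \<Rightarrow> coeffs \<Rightarrow> coeffs" is free_op
  by (rule K_cong_free_op)

lemma K_op_plus: "K_op (a + b) g = (\<lambda>k m. K_op a g k m + K_op b g k m)"
  by transfer (rule free_op_plus)

lemma K_op_times: "K_op (a * b) g = K_op a (K_op b g)"
  by transfer (rule free_op_times)

lemma K_op_scale: "K_op (K_scale r a) g = (\<lambda>k m. r * K_op a g k m)"
  by transfer (simp add: free_op_times free_scalar_def free_op_single zero_gen_word_def)

lemma K_op_zero: "K_op 0 g = (\<lambda>k m. 0)"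
  by transfer (rule free_op_zero)

lemma K_op_one: "K_op 1 g = g"
  by transfer (rule free_op_one)

lemma K_op_gen: "K_op (K_gen a) g = gen_op a g"
  by transfer (rule free_op_gen)

lemma K_op_add_right: "K_op a (\<lambda>k m. g k m + h k m) = (\<lambda>k m. K_op a g k m + K_op a h k m)"
  by transfer (rule free_op_add_right)

lemma K_op_scale_right: "K_op a (\<lambda>k m. r * g k m) = (\<lambda>k m. r * K_op a g k m)"
  by transfer (rule free_op_scale_right)

section \<open>The filtered algebra\<close>

lemma free_scalar_central: "p * free_scalar r = free_scalar r * p"
  by (induction p rule: poly_mapping_single_add_induct)
    (simp_all add: free_scalar_def mult_single distrib_left distrib_right mult.commute)

lemma free_scalar_plus: "free_scalar (r + s) = free_scalar r + free_scalar s"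
  by (simp add: free_scalar_def single_add)

lemma free_scalar_times: "free_scalar (r * s) = free_scalar r * free_scalar s"
  by (simp add: free_scalar_def mult_single)

lemma free_scalar_one: "free_scalar 1 = 1"
  by (simp add: free_scalar_def)

lemma K_scale_mult_left: "K_scale r a * b = K_scale r (a * b)"
  by transfer (simp add: mult.assoc K_cong.refl)

lemma K_scale_mult_right: "a * K_scale r b = K_scale r (a * b)"
  by transfer (metis K_cong.refl free_scalar_central mult.assoc)

interpretation K: vector_space K_scale
proof
  fix r s a b
  show "K_scale r (a + b) = K_scale r a + K_scale r b"
    by transfer (simp add: distrib_left K_cong.refl)
  show "K_scale (r + s) a = K_scale r a + K_scale s a"
    by transfer (simp add: free_scalar_plus distrib_right K_cong.refl)
  show "K_scale r (K_scale s a) = K_scale (r * s) a"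
    by transfer (simp add: free_scalar_times mult.assoc K_cong.refl)
  show "K_scale 1 a = a"
    by transfer (simp add: free_scalar_one K_cong.refl)
qed

lemma K_filt_word: "word_degree w \<le> n \<Longrightarrow> prod_list (map K_gen w) \<in> K_filt n"
  unfolding K_filt_def by (rule K.span_base) blast

lemma K_filt_gen: "gen_degree a \<le> n \<Longrightarrow> K_gen a \<in> K_filt n"
  using K_filt_word[of "[a]" n] by (simp add: word_degree_def)

lemma K_filt_induct [consumes 1, case_names zero add]:
  assumes "a \<in> K_filt n" "Q 0"
    and "\<And>r w a. word_degree w \<le> n \<Longrightarrow> Q a \<Longrightarrow> Q (K_scale r (prod_list (map K_gen w)) + a)"
  shows "Q a"
  using assms(1) unfolding K_filt_def
  by (induction rule: K.span_induct_alt) (use assms(2,3) in auto)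

lemma K_filt_subspace: "K.subspace (K_filt n)"
  by (simp add: K_filt_def K.subspace_span)

text \<open>Degrees add under concatenation of words; the two nested inductions reduce to that
  case.\<close>

lemma K_filt_times:
  assumes "a \<in> K_filt l" "b \<in> K_filt n"
  shows "a * b \<in> K_filt (l + n)"
  using assms(1)
proof (induction rule: K_filt_induct)
  case zero
  then show ?case by (simp add: K.subspace_0[OF K_filt_subspace])
next
  case (add r w a)
  have "prod_list (map K_gen w) * b \<in> K_filt (l + n)"
    using assms(2)
  proof (induction rule: K_filt_induct)
    case zero
    then show ?case by (simp add: K.subspace_0[OF K_filt_subspace])
  next
    case (add s u b)
    have "prod_list (map K_gen w) * prod_list (map K_gen u) \<in> K_filt (l + n)"
      using K_filt_word[of "w @ u" "l + n"] add(1) \<open>word_degree w \<le> l\<close> by (simp add: word_degree_def)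
    with add show ?case
      by (simp add: distrib_left K_scale_mult_right K.subspace_add[OF K_filt_subspace]
          K.subspace_scale[OF K_filt_subspace])
  qed
  with add show ?case
    by (simp add: distrib_right K_scale_mult_left K.subspace_add[OF K_filt_subspace]
        K.subspace_scale[OF K_filt_subspace])
qed

lemma K_filtered_algebra: "filtered_algebra K_scale K_filt"
proof
  show "K_filt n \<subseteq> K_filt (Suc n)" for n
    unfolding K_filt_def by (rule K.span_mono) force
qed (fact K_scale_mult_left K_scale_mult_right K_filt_subspace K_filt_times)+

section \<open>Coordinates on the Grothendieck space\<close>

context TL_space
begin

definition basis :: "'v set"
  where "basis = (\<lambda>(n, m). W n m) ` TL_index"

lemma basis_independent: "independent basis" and basis_span: "span basis = UNIV"
  unfolding basis_def by (fact W_independent W_span)+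

text \<open>The embedding into the enlarged space: genuine vectors have no component at negative
  \<open>m\<close>.\<close>

definition coords :: "'v \<Rightarrow> coeffs" where
  "coords v k m = (if m < 0 then 0 else representation basis v (W (2 * int k + m) m))"

lemma coords_add: "coords (v + w) = (\<lambda>k m. coords v k m + coords w k m)"
  by (auto simp: fun_eq_iff coords_def representation_add basis_independent basis_span)

lemma coords_scale: "coords (scale r v) = (\<lambda>k m. r * coords v k m)"
  by (auto simp: fun_eq_iff coords_def representation_scale basis_independent basis_span)

lemma coords_zero: "coords 0 = (\<lambda>k m. 0)"
  by (auto simp: fun_eq_iff coords_def representation_zero)

lemma coords_W:
  "coords (W n m) = (\<lambda>k m'. if (n, m) \<in> TL_index \<and> m' = m \<and> n = 2 * int k + m then 1 else 0)"
proof (cases "(n, m) \<in> TL_index")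
  case True
  have mem: "(2 * int k + m', m') \<in> TL_index" if "\<not> m' < 0" for k m'
    using that by (simp add: TL_index_def)
  have eq: "W (2 * int k + m') m' = W n m \<longleftrightarrow> 2 * int k + m' = n \<and> m' = m" if "\<not> m' < 0" for k m'
    using inj_on_eq_iff[OF W_inj mem[OF that] True] by simp
  have B: "W n m \<in> basis"
    unfolding basis_def using True by force
  have "m \<ge> 0" using True by (simp add: TL_index_def)
  with True show ?thesis
    unfolding coords_def representation_basis[OF basis_independent B]
    by (auto simp: fun_eq_iff eq)
next
  case False
  then show ?thesis by (simp add: W_zero coords_zero)
qed

text \<open>No basis vector escapes the coordinates: parity and \<open>m\<close> \<le>
  \<open>n\<close> make \<open>k = (n - m) / 2\<close> a natural number with
  \<open>n = 2 * k + m\<close>.\<close>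

lemma coords_eq_zero_imp: "v = 0" if "coords v = (\<lambda>k m. 0)"
proof -
  have "representation basis v b = 0" for b
  proof (cases "b \<in> basis")
    case True
    then obtain n m where nm: "(n, m) \<in> TL_index" "b = W n m" by (auto simp: basis_def)
    then have "0 \<le> m" and n: "2 * int (nat ((n - m) div 2)) + m = n"
      by (auto simp: TL_index_def)
    with nm(2) fun_cong[OF fun_cong[OF that], of "nat ((n - m) div 2)" m] show ?thesis
      unfolding coords_def n by simp
  next
    case False
    then show ?thesis using representation_ne_zero by blast
  qed
  then show ?thesis
    using sum_nonzero_representation_eq[OF basis_independent, of v] basis_span by simp
qed

lemma coords_inj: "inj coords"
proof (rule injI)
  fix v w assume "coords v = coords w"
  then have "coords (v + scale (- 1) w) = (\<lambda>k m. 0)"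
    by (simp only: coords_add coords_scale) simp
  then have "v + scale (- 1) w = 0" by (rule coords_eq_zero_imp)
  then show "v = w" by simp
qed

section \<open>Generators acting on the filtration\<close>

lemma TL_filt_subspace: "subspace (TL_filt j)"
  by (simp add: TL_filt_def subspace_span)

lemma TL_filt_antimono: "i \<le> j \<Longrightarrow> TL_filt j \<subseteq> TL_filt i"
  unfolding TL_filt_def by (rule span_mono) force

lemma W_in_TL_filt: "int j \<le> m \<Longrightarrow> W n m \<in> TL_filt j"
  unfolding TL_filt_def using W_zero[of n m] span_zero
  by (cases "(n, m) \<in> TL_index") (auto intro!: span_base)

definition gen_endo :: "gen \<Rightarrow> 'v \<Rightarrow> 'v" where
  "gen_endo a = (case a of GenX \<Rightarrow> Ind | GenY \<Rightarrow> Res | GenC k \<Rightarrow> P k)"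

lemma gen_endo_linear: "Vector_Spaces.linear scale scale (gen_endo a)"
  by (cases a) (simp_all add: gen_endo_def Ind_linear Res_linear P_linear)

text \<open>Here the bound on \<open>m\<close> matters. For \<open>m = 0\<close> induction and
  restriction lose their term at \<open>m - 1 = -1\<close>, whereas \<open>gen_op\<close> keeps it;
  for \<open>m\<close> \<ge> 1 both sides agree.\<close>

lemma gen_endo_W:
  assumes "(n, m) \<in> TL_index" "m \<ge> int (gen_degree a + j)"
  shows "gen_endo a (W n m) \<in> TL_filt j"
    and "coords (gen_endo a (W n m)) = gen_op a (coords (W n m))"
proof -
  show "gen_endo a (W n m) \<in> TL_filt j"
    using assms
    by (cases a) (auto simp: gen_endo_def Ind_W Res_W P_W subspace_0[OF TL_filt_subspace]
        intro!: subspace_add[OF TL_filt_subspace] W_in_TL_filt)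
  show "coords (gen_endo a (W n m)) = gen_op a (coords (W n m))"
  proof (cases a)
    case GenX
    with assms show ?thesis
      by (auto simp: gen_endo_def Ind_W coords_add coords_W fun_eq_iff TL_index_def)
  next
    case GenY
    with assms show ?thesis
      by (auto simp: gen_endo_def Res_W coords_add coords_W fun_eq_iff TL_index_def)
  next
    case (GenC k)
    with assms show ?thesis
      by (auto simp: gen_endo_def P_W coords_zero coords_W fun_eq_iff)
  qed
qed

lemma gen_endo_TL_filt:
  assumes "v \<in> TL_filt (gen_degree a + j)"
  shows "gen_endo a v \<in> TL_filt j \<and> coords (gen_endo a v) = gen_op a (coords v)"
  using assms unfolding TL_filt_def[of "gen_degree a + j"]
proof (induction rule: span_induct_alt)
  case base
  interpret Vector_Spaces.linear scale scale "gen_endo a" by (rule gen_endo_linear)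
  show ?case
    \<comment> \<open>Linearity of \<open>gen_op a\<close> is that of \<open>word_op\<close> on a
      one-letter word.\<close>
    using word_op_zero[of "[a]"] by (simp add: zero coords_zero subspace_0[OF TL_filt_subspace])
next
  case (step c x y)
  interpret Vector_Spaces.linear scale scale "gen_endo a" by (rule gen_endo_linear)
  show ?case
    using step gen_endo_W word_op_add[of "[a]"] word_op_scale[of "[a]"]
    by (auto simp: add scale coords_add coords_scale
        intro!: subspace_add[OF TL_filt_subspace] subspace_scale[OF TL_filt_subspace])
qed

text \<open>The image computed in the enlarged space is again the coordinate function of a genuine
  vector, because each letter lowers the filtration by at most its own degree.\<close>

lemma word_action:
  assumes "v \<in> TL_filt (word_degree w + j)"
  shows "\<exists>u \<in> TL_filt j. coords u = K_op (prod_list (map K_gen w)) (coords v)"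
  using assms
proof (induction w arbitrary: j)
  case Nil
  then show ?case by (auto simp: word_degree_def K_op_one)
next
  case (Cons a w)
  \<comment> \<open>The tail \<open>w\<close> acts first, so it must leave
    \<open>gen_degree a\<close> levels in reserve for the last letter \<open>a\<close>.\<close>
  have "v \<in> TL_filt (word_degree w + (gen_degree a + j))"
    using Cons.prems by (simp add: word_degree_def add_ac)
  then obtain u where "u \<in> TL_filt (gen_degree a + j)"
    "coords u = K_op (prod_list (map K_gen w)) (coords v)"
    using Cons.IH by blast
  then show ?case
    using gen_endo_TL_filt[of u a j] by (intro bexI[of _ "gen_endo a u"]) (auto simp: K_op_times K_op_gen)
qed

lemma K_action:
  assumes "a \<in> K_filt n" "n \<le> m" "v \<in> TL_filt m"
  shows "\<exists>u \<in> TL_filt (m - n). coords u = K_op a (coords v)"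
  using assms(1)
proof (induction rule: K_filt_induct)
  case zero
  then show ?case
    by (intro bexI[of _ 0]) (simp_all add: K_op_zero coords_zero subspace_0[OF TL_filt_subspace])
next
  case (add r w a)
  \<comment> \<open>Words of degree below \<open>n\<close> lose fewer levels than allowed; weakening
    the level of \<open>v\<close> makes all of them end in the same
    \<open>TL_filt (m - n)\<close>.\<close>
  then have "word_degree w + (m - n) \<le> m"
    using assms(2) by simp
  then have "v \<in> TL_filt (word_degree w + (m - n))"
    using assms(3) TL_filt_antimono by blast
  then obtain u where "u \<in> TL_filt (m - n)" "coords u = K_op (prod_list (map K_gen w)) (coords v)"
    using word_action by blast
  moreover obtain u' where "u' \<in> TL_filt (m - n)" "coords u' = K_op a (coords v)"
    using add by blast
  ultimately show ?case
    by (intro bexI[of _ "scale r u + u'"])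
      (simp_all add: coords_add coords_scale K_op_plus K_op_scale
        subspace_add[OF TL_filt_subspace] subspace_scale[OF TL_filt_subspace])
qed

text \<open>The enlarged action pulled back along \<open>coords\<close>. The value is meaningful
  when the image lies in the range of \<open>coords\<close>, as \<open>K_action\<close> ensures on
  the pairs of interest; elsewhere \<open>inv\<close> returns an arbitrary vector.\<close>

definition K_act :: "K_alg \<Rightarrow> 'v \<Rightarrow> 'v" where
  "K_act a v = inv coords (K_op a (coords v))"

lemma K_act_eqI: "K_op a (coords v) = coords u \<Longrightarrow> K_act a v = u"
  by (simp add: K_act_def inv_f_f[OF coords_inj])

lemma K_act:
  assumes "n \<le> m" "a \<in> K_filt n" "v \<in> TL_filt m"
  shows "K_act a v \<in> TL_filt (m - n)" and "coords (K_act a v) = K_op a (coords v)"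
  using K_action[OF assms(2,1,3)] K_act_eqI by metis+

lemma K_act_gen: "v \<in> TL_filt (gen_degree a) \<Longrightarrow> K_act (K_gen a) v = gen_endo a v"
  using gen_endo_TL_filt[of v a 0] by (intro K_act_eqI) (simp add: K_op_gen)

text \<open>One map serves all \<open>n\<close> and \<open>m\<close>, so compatibility with the
  inclusions is immediate. Bilinearity and multiplicativity carry over from \<open>K_op\<close> by
  injectivity of \<open>coords\<close>.\<close>

lemma K_act_asymptotic_representation:
  "asymptotic_representation K_scale K_filt scale TL_filt (\<lambda>n m. K_act)"
proof (intro asymptotic_representation.intro asymptotic_representation_axioms.intro)
  show "filtered_algebra K_scale K_filt"
    by (rule K_filtered_algebra)
  show "decreasing_filtered_space scale TL_filt"
    by unfold_locales (use TL_filt_subspace TL_filt_antimono in auto)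
next
  fix n m l a b v
  assume "n + l \<le> m" "a \<in> K_filt l" "b \<in> K_filt n" "v \<in> TL_filt m"
  \<comment> \<open>After \<open>b\<close> has acted, enough levels remain for \<open>a\<close>, so
    both successive coordinate functions are exact.\<close>
  moreover from this have "l \<le> m - n" "K_act b v \<in> TL_filt (m - n)"
    using K_act(1) by simp_all
  ultimately show "K_act (a * b) v = K_act a (K_act b v)"
    using K_act(2)[of n m b v] K_act(2)[of l "m - n" a "K_act b v"]
    by (intro K_act_eqI) (simp add: K_op_times)
qed (auto intro!: K_act_eqI simp: K_act coords_add coords_scale K_op_plus K_op_scale
    K_op_add_right K_op_scale_right)

end

theorem proposition8p9:
  fixes scale :: "cq \<Rightarrow> 'v::ab_group_add \<Rightarrow> 'v"
    and W :: "int \<Rightarrow> int \<Rightarrow> 'v"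
    and Ind Res :: "'v \<Rightarrow> 'v"
    and P :: "nat \<Rightarrow> 'v \<Rightarrow> 'v"
  assumes TL: "TL_space scale W Ind Res P"
  shows "\<exists>f. asymptotic_representation K_scale K_filt scale (TL_space.TL_filt scale W) f
    \<and> (\<forall>k. K_c k \<in> K_filt 0
        \<and> (\<forall>m. \<forall>v \<in> TL_space.TL_filt scale W m. f 0 m (K_c k) v = P k v))
    \<and> K_x \<in> K_filt 1 \<and> (\<forall>m \<ge> 1. \<forall>v \<in> TL_space.TL_filt scale W m. f 1 m K_x v = Ind v)
    \<and> K_y \<in> K_filt 1 \<and> (\<forall>m \<ge> 1. \<forall>v \<in> TL_space.TL_filt scale W m. f 1 m K_y v = Res v)"
proof -
  interpret TL_space scale W Ind Res P by (rule TL)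
  \<comment> \<open>\<open>TL_filt (gen_degree a)\<close> contains every \<open>TL_filt m\<close>
    with \<open>m\<close> at least the degree of \<open>a\<close>: all \<open>m\<close> for the
    projections, \<open>m\<close> \<ge> 1 for induction and restriction.\<close>
  have gen: "K_act (K_gen a) v = gen_endo a v" if "gen_degree a \<le> m" "v \<in> TL_filt m" for a m v
    using that TL_filt_antimono K_act_gen by blast
  show ?thesis
    unfolding K_x_def K_y_def K_c_def
    by (intro exI[of _ "\<lambda>n m. K_act"] conjI allI ballI impI K_act_asymptotic_representation K_filt_gen)
      (simp_all add: gen gen_endo_def)
qed

end
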